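(* Up to monomial equivalence, there is exactly one self-dual code over $I_5$ of length $2$ and exactly one self-dual code over $I_5$ of length $4$. They are represented by the codes with generator matrices $$\begin{pmatrix}\mathtt{a}&2\mathtt{a}\\0&\mathtt{b}\end{pmatrix}\quad\text{and}\quad\begin{pmatrix}\mathtt{a}&0&2\mathtt{a}&0\\0&\mathtt{a}&0&2\mathtt{a}\\0&0&\mathtt{b}&0\\0&0&0&\mathtt{b}\end{pmatrix},$$ of types $\{1,1\}$ and $\{2,2\}$, with automorphism groups of orders $4$ and $32$, respectively. Both have minimum distance $1$; the numbers of codewords of weight $1,2$ in the first are $8,116$, and the numbers of codewords of weight $1,2,3,4$ in the second are $16,296,1856,13456$.
   Context: $I_5$ is the commutative ring without unity of order 25 and characteristic 5 generated by $\mathtt{a},\mathtt{b}$ with relations $5\mathtt{a}=5\mathtt{b}=0$, $\mathtt{a}^2=\mathtt{b}$, $\mathtt{a}\mathtt{b}=0$ (hence $\mathtt{b}^2=0$); every element is uniquely $\mathtt{a}x+\mathtt{b}y$ with $x,y\in\mathbb{F}_5$. A linear code of length $n$ over $I_5$ is an $I_5$-submodule of $I_5^n$; the code with generator matrix $G$ is the smallest $I_5$-submodule (additive subgroup closed under multiplication by $I_5$) containing the rows of $G$. Let $\pi:I_5\to\mathbb{F}_5$, $\pi(\mathtt{a}x+\mathtt{b}y)=x$, extended coordinatewise; $\operatorname{res}(\mathcal{C})=\pi(\mathcal{C})$ and $\operatorname{tor}(\mathcal{C})=\{\mathbf{x}\in\mathbb{F}_5^n:\mathtt{b}\mathbf{x}\in\mathcal{C}\}$.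 $\mathcal{C}$ has type $\{k_1,k_2\}$ if $\dim\operatorname{res}(\mathcal{C})=k_1$ and $\dim\operatorname{tor}(\mathcal{C})=k_1+k_2$. $\mathcal{C}$ is self-dual if $\mathcal{C}=\mathcal{C}^\perp$, where $\mathcal{C}^\perp=\{\mathbf{y}\in I_5^n:\sum_i x_iy_i=0\ \forall\,\mathbf{x}\in\mathcal{C}\}$. Two codes $\mathcal{C},\mathcal{C}'$ of length $n$ are monomially equivalent if $\mathcal{C}'=\{\mathbf{c}M:\mathbf{c}\in\mathcal{C}\}$ for some $n\times n$ monomial matrix $M$ (exactly one nonzero entry in each row and column) with nonzero entries in $\{1,-1\}$; $\operatorname{Aut}(\mathcal{C})$ is the group of such $M$ with $\mathcal{C}M=\mathcal{C}$. The weight of a vector is its number of nonzero coordinates; the minimum distance is the least weight of a nonzero codeword. *)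

theory Defs
  imports
    "HOL-Analysis.Analysis"
    "HOL-Algebra.Coset"
    "Berlekamp_Zassenhaus.Finite_Field"
begin

section \<open>The field of five elements\<close>

instance Enum.finite_5 :: prime_card
proof
  have "CARD(Enum.finite_5) = 5"
    by (simp add: UNIV_finite_5)
  then show "prime CARD(Enum.finite_5)"
    by simp
qed

type_synonym F5 = "Enum.finite_5 mod_ring"


section \<open>The ring \<open>I\<^sub>5\<close>\<close>

text \<open>The element \<open>I5 x y\<close> stands for \<open>a x + b y\<close>; the relations \<open>a\<^sup>2 = b\<close> and
  \<open>a b = b\<^sup>2 = 0\<close> give \<open>(a x + b y) (a x' + b y') = b x x'\<close>.\<close>

datatype i5 = I5 (a_coord: F5) (b_coord: F5)

instantiation i5 :: comm_ring
begin

definition zero_i5 :: i5 where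
  "0 = I5 0 0"

definition plus_i5 :: "i5 \<Rightarrow> i5 \<Rightarrow> i5" where
  "r + s = I5 (a_coord r + a_coord s) (b_coord r + b_coord s)"

definition uminus_i5 :: "i5 \<Rightarrow> i5" where
  "- r = I5 (- a_coord r) (- b_coord r)"

definition minus_i5 :: "i5 \<Rightarrow> i5 \<Rightarrow> i5" where
  "r - s = I5 (a_coord r - a_coord s) (b_coord r - b_coord s)"

definition times_i5 :: "i5 \<Rightarrow> i5 \<Rightarrow> i5" where
  "r * s = I5 0 (a_coord r * a_coord s)"

instance
  by standard
    (auto simp: zero_i5_def plus_i5_def uminus_i5_def minus_i5_def times_i5_def algebra_simps)

end

definition gen_a :: i5 where
  "gen_a = I5 1 0"

definition gen_b :: i5 where
  "gen_b = I5 0 1"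

text \<open>Since \<open>5 r = 0\<close> for all \<open>r\<close>, the ring is a vector space over \<^typ>\<open>F5\<close>.\<close>

definition scale_i5 :: "F5 \<Rightarrow> i5 \<Rightarrow> i5" (infixr \<open>*\<^sub>5\<close> 75) where
  "x *\<^sub>5 r = I5 (x * a_coord r) (x * b_coord r)"

lemma CARD_F5: "CARD(F5) = 5"
  by (simp add: UNIV_finite_5)

lemma F5_char: "(5::F5) = 0"
proof -
  have "of_nat CARD(Enum.finite_5) = (0::F5)"
    by (simp add: of_nat_of_int_mod_ring of_int_mod_ring.abs_eq zero_mod_ring_def)
  then show ?thesis
    by (simp add: UNIV_finite_5)
qed

lemma i5_relations:
  "r + r + r + r + r = (0::i5)"
  "gen_a * gen_a = gen_b" "gen_a * gen_b = 0" "gen_b * gen_b = 0"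
proof -
  have "x + x + x + x + x = 0" for x :: F5
  proof -
    have "x + x + x + x + x = 5 * x" by (simp add: algebra_simps)
    then show ?thesis by (simp add: F5_char)
  qed
  then show "r + r + r + r + r = (0::i5)"
    by (simp add: zero_i5_def plus_i5_def)
qed (simp_all add: zero_i5_def gen_a_def gen_b_def times_i5_def)

lemma i5_unique_repr: "\<exists>!(x, y). r = x *\<^sub>5 gen_a + y *\<^sub>5 gen_b"
  by (cases r) (auto simp: scale_i5_def plus_i5_def gen_a_def gen_b_def)


section \<open>Codes over \<open>I\<^sub>5\<close>\<close>

definition linear_code :: "(i5 ^ 'n) set \<Rightarrow> bool" where
  "linear_code C \<longleftrightarrow>
     0 \<in> C \<and> (\<forall>x\<in>C. \<forall>y\<in>C. x + y \<in> C) \<and> (\<forall>x\<in>C. - x \<in> C) \<and> (\<forall>r. \<forall>x\<in>C. r *s x \<in> C)"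

text \<open>As \<open>I\<^sub>5\<close> has no unity, the rows need not lie in the set of their \<open>I\<^sub>5\<close>-linear
  combinations; the generated code is the least submodule containing them.\<close>

definition code_of :: "i5 ^ 'n ^ 'm \<Rightarrow> (i5 ^ 'n) set" where
  "code_of G = linear_code hull (rows G)"

definition res :: "(i5 ^ 'n) set \<Rightarrow> (F5 ^ 'n) set" where
  "res C = (\<lambda>c. \<chi> i. a_coord (c $ i)) ` C"

definition tor :: "(i5 ^ 'n) set \<Rightarrow> (F5 ^ 'n) set" where
  "tor C = {x. (\<chi> i. x $ i *\<^sub>5 gen_b) \<in> C}"

definition has_type :: "(i5 ^ 'n) set \<Rightarrow> nat \<Rightarrow> nat \<Rightarrow> bool" where
  "has_type C k1 k2 \<longleftrightarrow> vec.dim (res C) = k1 \<and> vec.dim (tor C) = k1 + k2"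

definition dual :: "(i5 ^ 'n) set \<Rightarrow> (i5 ^ 'n) set" where
  "dual C = {y. \<forall>x\<in>C. (\<Sum>i\<in>UNIV. x $ i * y $ i) = 0}"

definition self_dual :: "(i5 ^ 'n) set \<Rightarrow> bool" where
  "self_dual C \<longleftrightarrow> linear_code C \<and> C = dual C"

definition weight :: "i5 ^ 'n \<Rightarrow> nat" where
  "weight x = card {i. x $ i \<noteq> 0}"

definition weight_count :: "(i5 ^ 'n) set \<Rightarrow> nat \<Rightarrow> nat" where
  "weight_count C w = card {c \<in> C. weight c = w}"

definition min_distance :: "(i5 ^ 'n) set \<Rightarrow> nat" where
  "min_distance C = (LEAST w. \<exists>c\<in>C. c \<noteq> 0 \<and> weight c = w)"


section \<open>Monomial equivalence\<close>

definition monomial :: "F5 ^ 'n ^ 'n \<Rightarrow> bool" where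
  "monomial M \<longleftrightarrow> (\<forall>i. \<exists>!j. M $ i $ j \<noteq> 0) \<and> (\<forall>j. \<exists>!i. M $ i $ j \<noteq> 0)"

definition signed_monomial :: "F5 ^ 'n ^ 'n \<Rightarrow> bool" where
  "signed_monomial M \<longleftrightarrow> monomial M \<and> (\<forall>i j. M $ i $ j \<noteq> 0 \<longrightarrow> M $ i $ j \<in> {1, - 1})"

definition code_vec_mult :: "i5 ^ 'n \<Rightarrow> F5 ^ 'n ^ 'n \<Rightarrow> i5 ^ 'n" (infixl \<open>v*\<^sub>5\<close> 70) where
  "c v*\<^sub>5 M = (\<chi> j. \<Sum>i\<in>UNIV. M $ i $ j *\<^sub>5 c $ i)"

definition code_image :: "(i5 ^ 'n) set \<Rightarrow> F5 ^ 'n ^ 'n \<Rightarrow> (i5 ^ 'n) set" where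
  "code_image C M = {c v*\<^sub>5 M | c. c \<in> C}"

definition monomial_equiv :: "((i5 ^ 'n) set \<times> (i5 ^ 'n) set) set" where
  "monomial_equiv = {(C, C'). \<exists>M. signed_monomial M \<and> C' = code_image C M}"

definition Aut :: "(i5 ^ 'n) set \<Rightarrow> (F5 ^ 'n ^ 'n) monoid" where
  "Aut C = \<lparr>carrier = {M. signed_monomial M \<and> code_image C M = C}, mult = (**), one = mat 1\<rparr>"


lemma signed_monomial_iff:
  "signed_monomial M \<longleftrightarrow>
     (\<exists>p s. bij p \<and> (\<forall>i. s i \<in> {1, - 1}) \<and> M = (\<chi> i j. if j = p i then s i else 0))"
proof
  assume M: "signed_monomial M"
  then have r: "\<forall>i. \<exists>!j. M $ i $ j \<noteq> 0" and c: "\<forall>j. \<exists>!i. M $ i $ j \<noteq> 0"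
    and e: "\<And>i j. M $ i $ j \<noteq> 0 \<Longrightarrow> M $ i $ j \<in> {1, - 1}"
    by (auto simp: signed_monomial_def monomial_def)
  define p where "p i = (THE j. M $ i $ j \<noteq> 0)" for i
  have p: "M $ i $ j \<noteq> 0 \<longleftrightarrow> j = p i" for i j
    unfolding p_def using theI'[OF r[rule_format, of i]] r by blast
  have "bij p"
    unfolding bij_iff using c p by metis
  moreover have "M = (\<chi> i j. if j = p i then M $ i $ p i else 0)"
    using p by (auto simp: vec_eq_iff)
  moreover have "M $ i $ p i \<in> {1, - 1}" for i
    using e p by simp
  ultimately show "\<exists>p s. bij p \<and> (\<forall>i. s i \<in> {1, - 1}) \<and> M = (\<chi> i j. if j = p i then s i else 0)"
    by (intro exI[of _ p] exI[of _ "\<lambda>i. M $ i $ p i"] conjI allI)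
next
  assume "\<exists>p s. bij p \<and> (\<forall>i. s i \<in> {1, - 1}) \<and> M = (\<chi> i j. if j = p i then s i else 0)"
  then obtain p s where p: "bij p" and s: "\<And>i. s i \<in> {1, - 1}"
    and M: "M = (\<chi> i j. if j = p i then s i else 0)" by blast
  have nz: "M $ i $ j \<noteq> 0 \<longleftrightarrow> j = p i" for i j
    using s[of i] by (auto simp: M)
  have "\<exists>!i. j = p i" for j
    using p by (metis bij_pointE)
  then show "signed_monomial M"
    using s nz by (auto simp: signed_monomial_def monomial_def M)
qed

lemma signed_monomial_one: "signed_monomial (mat 1)"
  unfolding signed_monomial_iff
  by (intro exI[of _ id] exI[of _ "\<lambda>_. 1"]) (auto simp: mat_def vec_eq_iff)

lemma signed_monomial_mult:
  assumes "signed_monomial M" "signed_monomial N"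
  shows "signed_monomial (M ** N)"
proof -
  obtain p s q t where p: "bij p" "\<And>i. s i \<in> {1, - 1}" "M = (\<chi> i j. if j = p i then s i else 0)"
    and q: "bij q" "\<And>i. t i \<in> {1, - 1}" "N = (\<chi> i j. if j = q i then t i else 0)"
    using assms unfolding signed_monomial_iff by blast
  have "M ** N = (\<chi> i j. if j = (q \<circ> p) i then s i * t (p i) else 0)"
  proof -
    have "(\<Sum>k\<in>UNIV. (if k = p i then s i else 0) * (if j = q k then t k else 0)) =
          (\<Sum>k\<in>UNIV. if k = p i then s i * (if j = q k then t k else 0) else 0)" for i j
      by (intro sum.cong) auto
    then show ?thesis
      by (auto simp: p q matrix_matrix_mult_def vec_eq_iff)
  qed
  moreover have "s i * t (p i) \<in> {1, - 1}" for i
    using p(2)[of i] q(2)[of "p i"] by auto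
  ultimately show ?thesis
    unfolding signed_monomial_iff using bij_comp[OF p(1) q(1)]
    by (intro exI[of _ "q \<circ> p"] exI[of _ "\<lambda>i. s i * t (p i)"] conjI allI)
qed

lemma signed_monomial_transpose:
  assumes "signed_monomial M"
  shows "signed_monomial (transpose M)" "transpose M ** M = mat 1" "M ** transpose M = mat 1"
proof -
  obtain p s where p: "bij p" "\<And>i. s i \<in> {1, - 1}" "M = (\<chi> i j. if j = p i then s i else 0)"
    using assms unfolding signed_monomial_iff by blast
  show "signed_monomial (transpose M)"
    using assms by (auto simp: signed_monomial_def monomial_def transpose_def)
  have sq: "s i * s i = 1" for i
    using p(2)[of i] by auto
  have "(\<Sum>k\<in>UNIV. (if k = p i then s i else 0) * (if k = p j then s j else 0)) =
        (\<Sum>k\<in>UNIV. if k = p i then s i * (if k = p j then s j else 0) else 0)" for i j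
    by (intro sum.cong) auto
  moreover have "p i = p j \<longleftrightarrow> i = j" for i j
    using p(1) by (metis bij_pointE)
  ultimately show MMt: "M ** transpose M = mat 1"
    using sq by (auto simp: p(3) matrix_matrix_mult_def transpose_def mat_def vec_eq_iff)
  then show "transpose M ** M = mat 1"
    by (simp add: matrix_left_right_inverse)
qed

lemma code_vec_mult_one:
  fixes c :: "i5 ^ 'n"
  shows "c v*\<^sub>5 mat 1 = c"
proof -
  have "(mat 1 :: F5 ^ 'n ^ 'n) $ i $ j *\<^sub>5 c $ i = (if i = j then c $ i else 0)" for i j
    by (auto simp: mat_def scale_i5_def zero_i5_def)
  then show ?thesis
    by (simp add: code_vec_mult_def vec_eq_iff)
qed

lemma scale_i5_zero: "x *\<^sub>5 0 = 0" "0 *\<^sub>5 r = 0"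
  by (simp_all add: scale_i5_def zero_i5_def)

lemma scale_i5_add: "x *\<^sub>5 (r + s) = x *\<^sub>5 r + x *\<^sub>5 s" "(x + y) *\<^sub>5 r = x *\<^sub>5 r + y *\<^sub>5 r"
  by (simp_all add: scale_i5_def plus_i5_def algebra_simps)

lemma scale_i5_sum:
  "x *\<^sub>5 (\<Sum>i\<in>A. f i) = (\<Sum>i\<in>A. x *\<^sub>5 f i)"
  "(\<Sum>i\<in>A. g i) *\<^sub>5 r = (\<Sum>i\<in>A. g i *\<^sub>5 r)"
  by (induction A rule: infinite_finite_induct) (simp_all add: scale_i5_zero scale_i5_add)

lemma scale_i5_scale_i5: "x *\<^sub>5 y *\<^sub>5 r = (x * y) *\<^sub>5 r"
  by (simp add: scale_i5_def)

lemma code_vec_mult_mult: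
  fixes c :: "i5 ^ 'n"
  shows "c v*\<^sub>5 M v*\<^sub>5 N = c v*\<^sub>5 (M ** N)"
proof -
  have "(\<Sum>i\<in>UNIV. \<Sum>k\<in>UNIV. (N $ i $ j * M $ k $ i) *\<^sub>5 c $ k) =
        (\<Sum>k\<in>UNIV. \<Sum>i\<in>UNIV. (M $ k $ i * N $ i $ j) *\<^sub>5 c $ k)" for j
    by (subst sum.swap) (simp add: mult.commute)
  then show ?thesis
    by (simp add: code_vec_mult_def matrix_matrix_mult_def vec_eq_iff scale_i5_sum scale_i5_scale_i5)
qed

lemma code_image_one: "code_image C (mat 1) = C"
  by (simp add: code_image_def code_vec_mult_one)

lemma code_image_mult: "code_image (code_image C M) N = code_image C (M ** N)"
  by (auto simp: code_image_def simp flip: code_vec_mult_mult)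

lemma equiv_monomial_equiv: "equiv UNIV monomial_equiv"
proof (rule equivI)
  show "refl monomial_equiv"
    unfolding refl_on_def monomial_equiv_def
    using signed_monomial_one code_image_one by blast
  show "sym monomial_equiv"
  proof (rule symI)
    fix C C' :: "(i5 ^ 'n) set" assume "(C, C') \<in> monomial_equiv"
    then obtain M where M: "signed_monomial M" "C' = code_image C M"
      unfolding monomial_equiv_def by blast
    then have "C = code_image C' (transpose M)"
      by (simp add: code_image_mult signed_monomial_transpose code_image_one)
    then show "(C', C) \<in> monomial_equiv"
      using signed_monomial_transpose(1)[OF M(1)] unfolding monomial_equiv_def by blast
  qed
  show "trans monomial_equiv"
  proof (rule transI)
    fix C C' C'' :: "(i5 ^ 'n) set"
    assume "(C, C') \<in> monomial_equiv" "(C', C'') \<in> monomial_equiv"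
    then obtain M N where "signed_monomial M" "signed_monomial N"
      "C'' = code_image (code_image C M) N"
      unfolding monomial_equiv_def by blast
    then show "(C, C'') \<in> monomial_equiv"
      unfolding monomial_equiv_def code_image_mult using signed_monomial_mult by blast
  qed
qed simp

lemma group_Aut: "group (Aut C)"
proof (rule groupI)
  fix M assume "M \<in> carrier (Aut C)"
  then have M: "signed_monomial M" "code_image C M = C"
    by (simp_all add: Aut_def)
  have "code_image C (transpose M) = code_image (code_image C M) (transpose M)"
    by (simp only: M(2))
  then have "code_image C (transpose M) = C"
    by (simp add: code_image_mult signed_monomial_transpose[OF M(1)] code_image_one)
  then have "transpose M \<in> carrier (Aut C)" "transpose M \<otimes>\<^bsub>Aut C\<^esub> M = \<one>\<^bsub>Aut C\<^esub>"
    using signed_monomial_transpose[OF M(1)] by (simp_all add: Aut_def)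
  then show "\<exists>N\<in>carrier (Aut C). N \<otimes>\<^bsub>Aut C\<^esub> M = \<one>\<^bsub>Aut C\<^esub>"
    by blast
next
  fix M N assume "M \<in> carrier (Aut C)" "N \<in> carrier (Aut C)"
  then show "M \<otimes>\<^bsub>Aut C\<^esub> N \<in> carrier (Aut C)"
    using code_image_mult[of C M N] by (simp add: Aut_def signed_monomial_mult)
qed (simp_all add: Aut_def signed_monomial_one code_image_one matrix_mul_assoc)


section \<open>The two generator matrices\<close>

definition G2 :: "i5 ^ 2 ^ 2" where
  "G2 = vector
    [vector [gen_a, 2 *\<^sub>5 gen_a],
     vector [0,     gen_b]]"

definition G4 :: "i5 ^ 4 ^ 4" where
  "G4 = vector
    [vector [gen_a, 0,     2 *\<^sub>5 gen_a, 0],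
     vector [0,     gen_a, 0,          2 *\<^sub>5 gen_a],
     vector [0,     0,     gen_b,      0],
     vector [0,     0,     0,          gen_b]]"

end

(* The product of x and y in I_5^n is b times the dot product of their residues, so the dual of C
   is the full preimage of the orthogonal complement of res(C).  Hence self-dual codes are exactly
   the preimages of self-dual codes D over F_5.

   Nonzero squares in F_5 are 1 and -1, so three nonzero squares never sum to 0.  In length 4, D has
   a nonzero word vanishing at one coordinate, hence at a second one; orthogonality to this word
   and to a word vanishing on its support splits D into two codes of length 2.  A self-dual code of
   length 2 is v_k = 2 v_j for one of the two orderings of the coordinates, so that coordinate
   permutations alone already identify all self-dual codes. *)
theory Submission
  imports Defs
begin

section \<open>Arithmetic in the field of five elements\<close>

text \<open>The elements 0, 1, -1, 2, -2 serve as normal forms: 3 and 4 are rewritten into them and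
  the inequalities keep them apart, so that simp settles the cases produced by
  \<open>F5_exhaust\<close>.\<close>

lemma F5_simps [simp]:
  "(3::F5) = - 2" "(4::F5) = - 1" "(5::F5) = 0" "(2::F5) \<noteq> 0" "(0::F5) \<noteq> 2"
  "(1::F5) \<noteq> 2" "(2::F5) \<noteq> 1" "(1::F5) \<noteq> - 1" "(- 1 ::F5) \<noteq> 1"
  "(1::F5) \<noteq> - 2" "(- 2 ::F5) \<noteq> 1" "(2::F5) \<noteq> - 1" "(- 1 ::F5) \<noteq> 2"
  "(2::F5) \<noteq> - 2" "(- 2 ::F5) \<noteq> 2"
proof -
  \<comment> \<open>The characteristic 5 divides no positive \<open>k\<close> below 5.\<close>
  have nz: "of_nat k \<noteq> (0::F5)" if "0 < k" "k < 5" for k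
    using that of_nat_eq_0_iff_char_dvd[of k, where 'a = F5]
    by (auto simp: CARD_F5 UNIV_finite_5 dest: dvd_imp_le)
  show two: "(2::F5) \<noteq> 0"
    using nz[of 2] by simp
  then show "(0::F5) \<noteq> 2"
    by (rule not_sym)
  have three: "(3::F5) \<noteq> 0" and four: "(4::F5) \<noteq> 0"
    using nz[of 3] nz[of 4] by simp_all
  show "(3::F5) = - 2" "(4::F5) = - 1" "(5::F5) = 0"
    using F5_char by (simp_all add: eq_neg_iff_add_eq_0)
  show one_two: "(1::F5) \<noteq> 2" "(2::F5) \<noteq> 1"
    by (metis add_cancel_left_right one_add_one one_neq_zero)+
  show "(1::F5) \<noteq> - 1" "(- 1 ::F5) \<noteq> 1"
    "(1::F5) \<noteq> - 2" "(- 2 ::F5) \<noteq> 1" "(2::F5) \<noteq> - 1" "(- 1 ::F5) \<noteq> 2"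
    "(2::F5) \<noteq> - 2" "(- 2 ::F5) \<noteq> 2"
    using two three four by (simp_all add: eq_neg_iff_add_eq_0 neg_eq_iff_add_eq_0)
qed

lemma F5_exhaust:
  fixes x :: F5
  obtains "x = 0" | "x = 1" | "x = - 1" | "x = 2" | "x = - 2"
proof -
  obtain i where i: "i < CARD(Enum.finite_5)" "x = of_nat i"
    using surj_of_nat_mod_ring by blast
  then have "i = 0 \<or> i = 1 \<or> i = 2 \<or> i = 3 \<or> i = 4"
    by (simp add: UNIV_finite_5) linarith
  then show thesis
    using that i(2) by auto
qed

lemma F5_three_squares:
  "a * a + b * b + c * c = 0 \<Longrightarrow> a = 0 \<or> b = 0 \<or> c = 0" for a b c :: F5
  by (cases a rule: F5_exhaust; cases b rule: F5_exhaust; cases c rule: F5_exhaust) simp_all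

text \<open>2 is a square root of -1 in the field; all isotropic words below come from this.\<close>

lemma F5_double_double [simp]: "2 * (2 * x) = - x" for x :: F5
proof -
  have "2 * (2 * x) = 4 * x" by (simp only: mult.assoc[symmetric]) simp
  then show ?thesis by simp
qed

lemma F5_add_double_eq_0_iff: "x + 2 * y = 0 \<longleftrightarrow> y = 2 * x" for x y :: F5
  by (metis F5_double_double add.commute add.left_inverse add_eq_0_iff mult_minus_right)

lemma F5_neg_eq_double_iff [simp]:
  "- x = 2 * y \<longleftrightarrow> y = 2 * x" "x = - (2 * y) \<longleftrightarrow> y = 2 * x" for x y :: F5
  by (simp_all only: neg_eq_iff_add_eq_0 eq_neg_iff_add_eq_0 F5_add_double_eq_0_iff)

text \<open>Since 4 = -1, the sum of squares factors as (b - 2a)(b + 2a). The root b = -2a is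
  written as a = 2b, so that the two cases differ by exchanging a and b.\<close>

lemma F5_two_squares:
  assumes "a * a + b * b = (0::F5)"
  shows "b = 2 * a \<or> a = 2 * b"
proof -
  have "(b - 2 * a) * (b + 2 * a) = b * b - 2 * (2 * (a * a))"
    by (simp add: algebra_simps)
  also have "\<dots> = 0"
    using assms by (simp only: F5_double_double) (simp add: algebra_simps)
  finally have "b - 2 * a = 0 \<or> b + 2 * a = 0"
    by simp
  then show ?thesis
    by (simp add: F5_add_double_eq_0_iff)
qed


section \<open>Self-dual codes as preimages of codes over the residue field\<close>

text \<open>The map behind \<open>res\<close>, named so that self-dual codes can be written as its
  preimages.\<close>

definition residue :: "i5 ^ 'n \<Rightarrow> F5 ^ 'n" where
  "residue c = (\<chi> i. a_coord (c $ i))"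

definition dot :: "F5 ^ 'n \<Rightarrow> F5 ^ 'n \<Rightarrow> F5" where
  "dot x y = (\<Sum>i\<in>UNIV. x $ i * y $ i)"

definition perp :: "(F5 ^ 'n) set \<Rightarrow> (F5 ^ 'n) set" where
  "perp D = {y. \<forall>x\<in>D. dot x y = 0}"

lemma residue_nth [simp]: "residue c $ i = a_coord (c $ i)"
  by (simp add: residue_def)

lemma a_coord_simps [simp]:
  "a_coord 0 = 0" "a_coord (r + s) = a_coord r + a_coord s" "a_coord (- r) = - a_coord r"
  "a_coord (r * s) = 0" "a_coord (x *\<^sub>5 r) = x * a_coord r"
  by (simp_all add: zero_i5_def plus_i5_def uminus_i5_def times_i5_def scale_i5_def)

lemma b_coord_simps [simp]:
  "b_coord 0 = 0" "b_coord (r + s) = b_coord r + b_coord s" "b_coord (- r) = - b_coord r"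
  "b_coord (r * s) = a_coord r * a_coord s" "b_coord (x *\<^sub>5 r) = x * b_coord r"
  by (simp_all add: zero_i5_def plus_i5_def uminus_i5_def times_i5_def scale_i5_def)

lemma i5_eq_iff: "r = s \<longleftrightarrow> a_coord r = a_coord s \<and> b_coord r = b_coord s" for r s :: i5
  by (metis i5.expand)

lemma coord_sum:
  "a_coord (sum f A) = (\<Sum>i\<in>A. a_coord (f i))" "b_coord (sum f A) = (\<Sum>i\<in>A. b_coord (f i))"
  by (induction A rule: infinite_finite_induct) simp_all

lemma surj_residue: "surj residue"
proof (rule surjI)
  show "residue (\<chi> i. I5 (v $ i) 0) = v" for v
    by (simp add: vec_eq_iff)
qed

lemma res_eq: "res C = residue ` C"
  by (simp add: res_def residue_def[abs_def])

lemma res_vimage: "res (residue -` D) = D"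
  by (simp add: res_eq surj_residue)

text \<open>Multiples of b have residue 0, so every vector over the field is a torsion word. This
  forces k1 + k2 = n.\<close>

lemma tor_vimage:
  fixes D :: "(F5 ^ 'n) set"
  assumes "0 \<in> D"
  shows "tor (residue -` D) = UNIV"
proof -
  have "residue (\<chi> i. x $ i *\<^sub>5 gen_b) = 0" for x :: "F5 ^ 'n"
    by (simp add: vec_eq_iff gen_b_def)
  then show ?thesis
    using assms by (simp add: tor_def)
qed

lemma dual_eq: "dual C = residue -` perp (res C)"
  by (auto simp: dual_def perp_def dot_def res_eq i5_eq_iff coord_sum)

text \<open>By \<open>dual_eq\<close>, \<open>C\<close> is the preimage of
  \<open>perp (res C)\<close>; applying the surjection \<open>residue\<close> to both sides gives
  \<open>res C = perp (res C)\<close>.\<close>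

lemma self_dual_imp_vimage:
  assumes "self_dual C"
  shows "C = residue -` res C" "perp (res C) = res C"
proof -
  have C: "C = residue -` perp (res C)"
    using assms by (simp add: self_dual_def dual_eq)
  then show "perp (res C) = res C"
    by (metis res_vimage)
  then show "C = residue -` res C"
    using C by simp
qed

text \<open>Closure under the ring is automatic: any product in I_5 has residue 0.\<close>

lemma linear_code_vimage_perp: "linear_code (residue -` perp D)"
  by (auto simp: linear_code_def perp_def dot_def algebra_simps sum.distrib sum_negf)

lemma self_dual_vimage:
  assumes "perp D = D"
  shows "self_dual (residue -` D)"
  using assms linear_code_vimage_perp[of D] by (simp add: self_dual_def dual_eq res_vimage)


section \<open>Self-dual codes of lengths two and four over the residue field\<close>

text \<open>The residue code of \<open>G2\<close>: the line through (1, 2), which is isotropic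
  because 1 + 4 = 0.\<close>

definition E2 :: "(F5 ^ 2) set" where
  "E2 = {v. v $ 2 = 2 * v $ 1}"

text \<open>The residue code of \<open>G4\<close>: an orthogonal sum of two copies of
  \<open>E2\<close>, on positions 1, 3 and on positions 2, 4.\<close>

definition E4 :: "(F5 ^ 4) set" where
  "E4 = {v. v $ 3 = 2 * v $ 1 \<and> v $ 4 = 2 * v $ 2}"

lemma vector_4 [simp]:
  "(vector [x, y, z, w] :: 'a::zero ^ 4) $ 1 = x"
  "(vector [x, y, z, w] :: 'a::zero ^ 4) $ 2 = y"
  "(vector [x, y, z, w] :: 'a::zero ^ 4) $ 3 = z"
  "(vector [x, y, z, w] :: 'a::zero ^ 4) $ 4 = w"
  unfolding vector_def by simp_all

lemma perp_E2: "perp E2 = E2"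
proof (intro equalityI subsetI)
  fix v assume "v \<in> perp E2"
  then have "dot (vector [1, 2]) v = 0"
    by (simp add: perp_def E2_def)
  then show "v \<in> E2"
    by (simp add: E2_def dot_def sum_2 F5_add_double_eq_0_iff)
next
  show "v \<in> perp E2" if "v \<in> E2" for v
    using that by (simp add: perp_def E2_def dot_def sum_2)
qed

lemma perp_E4: "perp E4 = E4"
proof (intro equalityI subsetI)
  fix v assume "v \<in> perp E4"
  then have "dot (vector [1, 0, 2, 0]) v = 0" "dot (vector [0, 1, 0, 2]) v = 0"
    by (simp_all add: perp_def E4_def)
  then show "v \<in> E4"
    by (simp add: E4_def dot_def sum_4 F5_add_double_eq_0_iff)
next
  show "v \<in> perp E4" if "v \<in> E4" for v
    using that by (simp add: perp_def E4_def dot_def sum_4)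
qed

section \<open>General properties of self-dual codes over the residue field\<close>

lemma perp_simps:
  assumes "perp D = D"
  shows perp_self_orthogonal: "x \<in> D \<Longrightarrow> y \<in> D \<Longrightarrow> dot x y = 0"
    and perp_memI: "(\<And>x. x \<in> D \<Longrightarrow> dot x y = 0) \<Longrightarrow> y \<in> D"
  using assms by (auto simp: perp_def)

text \<open>A self-dual code is maximal among self-orthogonal sets: each word of \<open>E\<close> is
  orthogonal to \<open>D\<close>, hence lies in \<open>perp D\<close>.\<close>

lemma perp_eqI:
  assumes "perp D = D" "D \<subseteq> E" "\<And>x y. x \<in> E \<Longrightarrow> y \<in> E \<Longrightarrow> dot x y = 0"
  shows "D = E"
  using assms perp_memI[OF assms(1)] by blast

text \<open>The zero code is orthogonal to everything; the all-ones vector is the witness.\<close>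

lemma self_perp_nonzero:
  fixes D :: "(F5 ^ 'n) set"
  assumes "perp D = D"
  shows "\<exists>w\<in>D. w \<noteq> 0"
proof (rule ccontr)
  assume no: "\<not> ?thesis"
  then have "dot x 1 = 0" if "x \<in> D" for x
    using that by (auto simp: dot_def)
  then have "(1 :: F5 ^ 'n) \<in> D"
    by (rule perp_memI[OF assms])
  then show False
    using no by (metis zero_neq_one)
qed

text \<open>Self-orthogonality makes \<open>u\<close> proportional to (1, 2) or (2, 1) on the
  positions j, k. Such a line in the plane is its own orthogonal complement, so every word
  orthogonal to \<open>u\<close> satisfies the same relation there.\<close>

lemma self_perp_pair:
  assumes D: "perp D = D" and u: "u \<in> D" "u \<noteq> 0" and jk: "j \<noteq> k" "\<And>i. i \<noteq> j \<Longrightarrow> i \<noteq> k \<Longrightarrow> u $ i = 0"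
  shows "(\<forall>v\<in>D. v $ k = 2 * v $ j) \<or> (\<forall>v\<in>D. v $ j = 2 * v $ k)"
proof -
  have dot_u: "dot u v = u $ j * v $ j + u $ k * v $ k" for v
  proof -
    have "dot u v = (\<Sum>i\<in>{j, k}. u $ i * v $ i)"
      unfolding dot_def using jk(2) by (intro sum.mono_neutral_right) auto
    then show ?thesis using jk(1) by simp
  qed
  have nz: "u $ j \<noteq> 0 \<or> u $ k \<noteq> 0"
    using u(2) jk(2) by (metis vec_eq_iff zero_index)
  have v: "u $ j * v $ j + u $ k * v $ k = 0" if "v \<in> D" for v
    using perp_self_orthogonal[OF D u(1) that] dot_u by simp
  consider "u $ k = 2 * u $ j" | "u $ j = 2 * u $ k"
    using F5_two_squares v[OF u(1)] by blast
  then show ?thesis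
  proof cases
    case 1
    have "v $ k = 2 * v $ j" if "v \<in> D" for v
    proof -
      have "u $ j * (v $ j + 2 * v $ k) = 0"
        using v[OF that] 1 by (simp add: algebra_simps)
      then have "v $ j + 2 * v $ k = 0"
        using nz 1 by simp
      then show ?thesis
        by (simp add: F5_add_double_eq_0_iff)
    qed
    then show ?thesis by blast
  next
    case 2
    have "v $ j = 2 * v $ k" if "v \<in> D" for v
    proof -
      have "u $ k * (v $ k + 2 * v $ j) = 0"
        using v[OF that] 2 by (simp add: algebra_simps)
      then have "v $ k + 2 * v $ j = 0"
        using nz 2 by simp
      then show ?thesis
        by (simp add: F5_add_double_eq_0_iff)
    qed
    then show ?thesis by blast
  qed
qed

lemma perp_subspace:
  assumes "x \<in> perp D" "y \<in> perp D"
  shows "x - a *s y \<in> perp D"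
proof -
  have "dot z (x - a *s y) = dot z x - a * dot z y" for z
    by (simp add: dot_def algebra_simps sum_subtractf sum_distrib_left)
  then show ?thesis
    using assms by (simp add: perp_def)
qed

text \<open>If \<open>D\<close> had no such word, it would be spanned by any \<open>w \<in> D\<close> with \<open>w $ i \<noteq> 0\<close>; but some
  nonzero \<open>y\<close> orthogonal to \<open>w\<close> vanishes at \<open>i\<close>, and \<open>y \<in> perp D\<close>.\<close>

lemma self_perp_word_vanishing_at:
  fixes D :: "(F5 ^ 'n) set"
  assumes D: "perp D = D" and ijk: "i \<noteq> j" "i \<noteq> k" "j \<noteq> k"
  shows "\<exists>u\<in>D. u \<noteq> 0 \<and> u $ i = 0"
proof (rule ccontr)
  assume no: "\<not> ?thesis"
  obtain w where w: "w \<in> D" "w $ i \<noteq> 0"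
    using self_perp_nonzero[OF D] no by blast
  have span: "v = (v $ i / w $ i) *s w" if "v \<in> D" for v
  proof -
    have "v - (v $ i / w $ i) *s w \<in> D"
      using perp_subspace[of v D w] that w(1) D by simp
    then show ?thesis
      using no w(2) by force
  qed
  \<comment> \<open>The general choice would be 0 when both entries of \<open>w\<close> at j and k
    vanish; the case split keeps \<open>y\<close> nonzero.\<close>
  define y :: "F5 ^ 'n" where
    "y = (if w $ j = 0 then axis j 1 else axis j (- w $ k) + axis k (w $ j))"
  have "dot w (axis l a) = w $ l * a" for l a
    by (simp add: dot_def axis_def if_distrib cong: if_cong)
  moreover have "dot w (x + z) = dot w x + dot w z" for x z
    by (simp add: dot_def algebra_simps sum.distrib)
  ultimately have wy: "dot w y = 0"
    by (simp add: y_def)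
  have "dot v y = 0" if "v \<in> D" for v
  proof -
    have "dot (a *s w) y = a * dot w y" for a
      by (simp add: dot_def sum_distrib_left mult.assoc)
    then show ?thesis
      using span[OF that] wy by (metis mult_zero_right)
  qed
  then have yD: "y \<in> D"
    by (rule perp_memI[OF D])
  have "y $ i = 0" "y \<noteq> 0"
    using ijk by (auto simp: y_def axis_def vec_eq_iff)
  then show False
    using no yD by blast
qed

section \<open>Classification in lengths two and four up to coordinate permutations\<close>

lemma self_perp_2:
  fixes D :: "(F5 ^ 2) set"
  assumes D: "perp D = D"
  shows "\<exists>p. bij p \<and> D = {v. (\<chi> i. v $ p i) \<in> E2}"
proof -
  obtain w where w: "w \<in> D" "w \<noteq> 0"
    using self_perp_nonzero[OF D] by blast
  have "(\<forall>v\<in>D. v $ 2 = 2 * v $ 1) \<or> (\<forall>v\<in>D. v $ 1 = 2 * v $ 2)"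
    using self_perp_pair[OF D w, of 1 2] exhaust_2 by force
  moreover have "UNIV = {1, 2 :: 2}" "UNIV = {2, 1 :: 2}" "(1 :: 2) \<noteq> 2" "(2 :: 2) \<noteq> 1"
    using UNIV_2 by auto
  ultimately obtain j k :: 2
    where jk: "UNIV = {j, k}" "j \<noteq> k" and rel: "\<forall>v\<in>D. v $ k = 2 * v $ j"
    by blast
  \<comment> \<open>The coordinate equal to twice the other one comes second, as in
    \<open>E2\<close>.\<close>
  define p :: "2 \<Rightarrow> 2" where "p i = (if i = 1 then j else k)" for i
  have "range p = {j, k}"
    by (auto simp: UNIV_2 p_def)
  then have "range p = UNIV"
    by (simp only: jk(1))
  then have "bij p"
    by (simp add: bij_def finite_UNIV_surj_inj)
  moreover have "D = {v. v $ k = 2 * v $ j}"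
  proof (rule perp_eqI[OF D])
    have "dot x y = x $ j * y $ j + x $ k * y $ k" for x y :: "F5 ^ 2"
      using jk(2) by (simp add: dot_def jk(1))
    then show "dot x y = 0" if "x \<in> {v. v $ k = 2 * v $ j}" "y \<in> {v. v $ k = 2 * v $ j}" for x y
      using that by simp
  qed (use rel in blast)
  ultimately show ?thesis
    by (intro exI[of _ p]) (simp add: E2_def p_def)
qed

text \<open>The relation between j and k makes a word that vanishes at j vanish at k too. The
  resulting word lives on l and m, so the same lemma applies again with the two pairs
  exchanged.\<close>

lemma self_perp_4_word:
  fixes D :: "(F5 ^ 4) set"
  assumes D: "perp D = D" and u: "u \<in> D" "u \<noteq> 0" "u $ l = 0" "u $ m = 0"
    and jklm: "UNIV = {j, k, l, m}" "distinct [j, k, l, m]"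
  shows "(\<forall>v\<in>D. v $ k = 2 * v $ j) \<or> (\<forall>v\<in>D. v $ j = 2 * v $ k)"
    and "\<exists>v\<in>D. v \<noteq> 0 \<and> v $ j = 0 \<and> v $ k = 0"
proof -
  have "i = j \<or> i = k \<or> i = l \<or> i = m" for i
    using jklm(1) by blast
  then show pair: "(\<forall>v\<in>D. v $ k = 2 * v $ j) \<or> (\<forall>v\<in>D. v $ j = 2 * v $ k)"
    using self_perp_pair[OF D u(1,2), of j k] u(3,4) jklm(2) by force
  obtain v where v: "v \<in> D" "v \<noteq> 0" "v $ j = 0"
    using self_perp_word_vanishing_at[OF D, of j k l] jklm(2) by auto
  then have "v $ k = 0"
    using pair by force
  then show "\<exists>v\<in>D. v \<noteq> 0 \<and> v $ j = 0 \<and> v $ k = 0"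
    using v by blast
qed

lemma self_perp_4:
  fixes D :: "(F5 ^ 4) set"
  assumes D: "perp D = D"
  shows "\<exists>p. bij p \<and> D = {v. (\<chi> i. v $ p i) \<in> E4}"
proof -
  obtain u where u: "u \<in> D" "u \<noteq> 0" "u $ 1 = 0"
    using self_perp_word_vanishing_at[OF D, of 1 2 3] by auto
  have "u $ 2 * u $ 2 + u $ 3 * u $ 3 + u $ 4 * u $ 4 = 0"
    using perp_self_orthogonal[OF D u(1) u(1)] u(3) by (simp add: dot_def sum_4)
  then have "u $ 2 = 0 \<or> u $ 3 = 0 \<or> u $ 4 = 0"
    by (rule F5_three_squares)
  \<comment> \<open>One arrangement for each possible second zero m = 2, 3, 4: first the possible
    support j, k of \<open>u\<close>, then its zeros 1, m.\<close>
  moreover have "UNIV = {3, 4, 1, 2 :: 4}" "UNIV = {2, 4, 1, 3 :: 4}" "UNIV = {2, 3, 1, 4 :: 4}"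
    using UNIV_4 by auto
  moreover have "distinct [3, 4, 1, 2 :: 4]" "distinct [2, 4, 1, 3 :: 4]" "distinct [2, 3, 1, 4 :: 4]"
    by simp_all
  ultimately obtain j k m :: 4
    where jklm: "UNIV = {j, k, 1, m}" "distinct [j, k, 1, m]" and um: "u $ m = 0"
    by metis
  note jk = self_perp_4_word[OF D u um jklm]
  have "UNIV = {1, m, j, k}" "distinct [1, m, j, k]"
    using jklm by auto
  then have lm: "(\<forall>v\<in>D. v $ m = 2 * v $ 1) \<or> (\<forall>v\<in>D. v $ 1 = 2 * v $ m)"
    using jk(2) self_perp_4_word(1)[OF D] by metis
  \<comment> \<open>Each pair is renamed so that its second coordinate is twice its first.\<close>
  obtain j' k' where jk': "{j', k'} = {j, k}" "j' \<noteq> k'" "\<forall>v\<in>D. v $ k' = 2 * v $ j'"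
    using jk(1) jklm(2) that[of j k] that[of k j] by auto
  obtain l' m' where lm': "{l', m'} = {1, m}" "l' \<noteq> m'" "\<forall>v\<in>D. v $ m' = 2 * v $ l'"
    using lm jklm(2) that[of 1 m] that[of m 1] by auto
  have "UNIV = {j, k} \<union> {1, m}" "{j, k} \<inter> {1, m} = {}"
    using jklm by auto
  then have "UNIV = {j', k'} \<union> {l', m'}" "{j', k'} \<inter> {l', m'} = {}"
    by (simp_all only: jk'(1) lm'(1))
  then have all: "UNIV = {j', k', l', m'}" "distinct [j', k', l', m']"
    using jk'(2) lm'(2) by auto
  note rel = jk'(3) lm'(3)
  \<comment> \<open>\<open>E4\<close> ties 3 to 1 and 4 to 2, so the pairs go to positions 1, 3 and
    2, 4.\<close>
  define p :: "4 \<Rightarrow> 4" where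
    "p i = (if i = 1 then j' else if i = 2 then l' else if i = 3 then k' else m')" for i
  have p: "p 1 = j'" "p 2 = l'" "p 3 = k'" "p 4 = m'"
    by (simp_all add: p_def)
  have "range p = {j', l', k', m'}"
    by (simp add: UNIV_4 p)
  also have "\<dots> = UNIV"
    using all(1) by (simp only: insert_commute)
  finally have "bij p"
    by (simp add: bij_def finite_UNIV_surj_inj)
  moreover have "D = {v. v $ k' = 2 * v $ j' \<and> v $ m' = 2 * v $ l'}" (is "D = ?E")
  proof (rule perp_eqI[OF D])
    have "dot x y = x $ j' * y $ j' + x $ k' * y $ k' + (x $ l' * y $ l' + x $ m' * y $ m')"
      for x y :: "F5 ^ 4"
      using all(2) by (simp add: dot_def all(1))
    then show "dot x y = 0" if "x \<in> ?E" "y \<in> ?E" for x y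
      using that by simp
  qed (use rel in blast)
  ultimately show ?thesis
    by (intro exI[of _ p]) (simp add: E4_def p)
qed


section \<open>Signed permutations acting on codes\<close>

definition signed_perm :: "('n \<Rightarrow> 'n) \<Rightarrow> ('n \<Rightarrow> F5) \<Rightarrow> F5 ^ 'n ^ 'n" where
  "signed_perm p s = (\<chi> i j. if j = p i then s i else 0)"

lemma code_vec_mult_signed_perm:
  assumes "bij p"
  shows "(c v*\<^sub>5 signed_perm p s) $ p i = s i *\<^sub>5 c $ i"
proof -
  have "signed_perm p s $ k $ p i *\<^sub>5 c $ k = (if k = i then s i *\<^sub>5 c $ i else 0)" for k
    using bij_is_inj[OF assms] by (auto simp: signed_perm_def scale_i5_zero dest: injD)
  then show ?thesis
    by (simp add: code_vec_mult_def)
qed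

text \<open>Taking residues commutes with the action, and a sign is its own inverse; hence undoing
  the matrix reads position \<open>p i\<close> with the same sign \<open>s i\<close>.\<close>

lemma code_image_vimage:
  fixes s :: "'n::finite \<Rightarrow> F5"
  assumes p: "bij p" and s: "\<And>i. s i \<in> {1, - 1}"
  shows "code_image (residue -` D) (signed_perm p s) = residue -` {v. (\<chi> i. s i * v $ p i) \<in> D}"
proof (intro equalityI subsetI)
  have sq: "s i * (s i * x) = x" for i x
    using s[of i] by auto
  fix d :: "i5 ^ 'n"
  {
    assume "d \<in> code_image (residue -` D) (signed_perm p s)"
    then obtain c where c: "residue c \<in> D" "d = c v*\<^sub>5 signed_perm p s"
      by (auto simp: code_image_def)
    have "(\<chi> i. s i * residue d $ p i) = residue c"
      by (simp add: c(2) vec_eq_iff code_vec_mult_signed_perm[OF p] sq)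
    then show "d \<in> residue -` {v. (\<chi> i. s i * v $ p i) \<in> D}"
      using c(1) by simp
  next
    assume d: "d \<in> residue -` {v. (\<chi> i. s i * v $ p i) \<in> D}"
    define c where "c = (\<chi> i. s i *\<^sub>5 d $ p i)"
    have "(c v*\<^sub>5 signed_perm p s) $ p i = d $ p i" for i
      by (simp add: code_vec_mult_signed_perm[OF p] c_def i5_eq_iff sq)
    then have "c v*\<^sub>5 signed_perm p s = d"
      unfolding vec_eq_iff by (metis bij_pointE p)
    moreover have "residue c \<in> D"
      using d by (simp add: c_def residue_def)
    ultimately show "d \<in> code_image (residue -` D) (signed_perm p s)"
      by (auto simp: code_image_def)
  }
qed

lemma monomial_equiv_permuted:
  assumes "bij p"
  shows "(residue -` E, residue -` {v. (\<chi> i. v $ p i) \<in> E}) \<in> monomial_equiv"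
proof -
  have "signed_monomial (signed_perm p (\<lambda>_. 1))"
    unfolding signed_monomial_iff signed_perm_def
    using assms by (intro exI[of _ p] exI[of _ "\<lambda>_. 1"]) simp
  moreover have "code_image (residue -` E) (signed_perm p (\<lambda>_. 1))
      = residue -` {v. (\<chi> i. v $ p i) \<in> E}"
    using code_image_vimage[OF assms, of "\<lambda>_. 1" E] by simp
  ultimately show ?thesis
    unfolding monomial_equiv_def by blast
qed

section \<open>Uniqueness of the equivalence class\<close>

lemma self_dual_2_equiv:
  assumes "self_dual C"
  shows "(residue -` E2, C) \<in> monomial_equiv"
proof -
  obtain p where "bij p" "res C = {v. (\<chi> i. v $ p i) \<in> E2}"
    using self_perp_2[OF self_dual_imp_vimage(2)[OF assms]] by blast
  then have "(residue -` E2, residue -` res C) \<in> monomial_equiv"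
    by (simp only: monomial_equiv_permuted)
  then show ?thesis
    by (simp only: self_dual_imp_vimage(1)[OF assms, symmetric])
qed

lemma self_dual_4_equiv:
  assumes "self_dual C"
  shows "(residue -` E4, C) \<in> monomial_equiv"
proof -
  obtain p where "bij p" "res C = {v. (\<chi> i. v $ p i) \<in> E4}"
    using self_perp_4[OF self_dual_imp_vimage(2)[OF assms]] by blast
  then have "(residue -` E4, residue -` res C) \<in> monomial_equiv"
    by (simp only: monomial_equiv_permuted)
  then show ?thesis
    by (simp only: self_dual_imp_vimage(1)[OF assms, symmetric])
qed

lemma card_quotient_eq_1:
  assumes "equiv UNIV R" "x \<in> A" "\<And>y. y \<in> A \<Longrightarrow> (x, y) \<in> R"
  shows "card (A // R) = 1"
proof -
  have "A // R = {R `` {x}}"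
  proof (intro equalityI subsetI)
    fix X assume "X \<in> A // R"
    then obtain y where "y \<in> A" "X = R `` {y}"
      by (rule quotientE)
    then show "X \<in> {R `` {x}}"
      using equiv_class_eq[OF assms(1) assms(3)] by simp
  qed (use quotientI[OF assms(2)] in simp)
  then show ?thesis
    by simp
qed

lemma vimage_residue_inject: "residue -` A = residue -` B \<longleftrightarrow> A = B"
  by (metis surj_image_vimage_eq surj_residue)

text \<open>Preimages under a surjection agree only if the sets agree, so automorphisms over I_5 are
  exactly the signed permutations preserving the residue code.\<close>

lemma carrier_Aut_vimage:
  "carrier (Aut (residue -` D)) =
     {signed_perm p s | p s. bij p \<and> (\<forall>i. s i \<in> {1, - 1}) \<and> {v. (\<chi> i. s i * v $ p i) \<in> D} = D}"
proof -
  have "code_image (residue -` D) (signed_perm p s) = residue -` D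
      \<longleftrightarrow> {v. (\<chi> i. s i * v $ p i) \<in> D} = D"
    if "bij p" "\<forall>i. s i \<in> {1, - 1}" for p s
    using that by (subst code_image_vimage) (simp_all only: vimage_residue_inject)
  then show ?thesis
    unfolding Aut_def signed_monomial_iff signed_perm_def[symmetric] partial_object.simps
    by blast
qed


section \<open>The codes generated by the two matrices\<close>

text \<open>I_5 has no unity, so a field scalar is not multiplication by a ring element; it is
  repeated addition instead.\<close>

lemma linear_code_scale:
  assumes "linear_code C" "c \<in> C"
  shows "(\<chi> i. x *\<^sub>5 c $ i) \<in> C"
proof -
  obtain n where n: "x = of_nat n"
    using surj_of_nat_mod_ring by blast
  have "(\<chi> i. of_nat n *\<^sub>5 c $ i) \<in> C"
  proof (induction n)
    case 0
    have "(\<chi> i. of_nat 0 *\<^sub>5 c $ i) = 0"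
      by (simp add: vec_eq_iff scale_i5_zero)
    then show ?case
      using assms(1) by (simp add: linear_code_def)
  next
    case (Suc n)
    have "(\<chi> i. of_nat (Suc n) *\<^sub>5 c $ i) = c + (\<chi> i. of_nat n *\<^sub>5 c $ i)"
      by (simp add: vec_eq_iff i5_eq_iff algebra_simps)
    then show ?case
      using Suc assms by (simp add: linear_code_def)
  qed
  then show ?thesis
    by (simp add: n)
qed

lemma linear_code_hull: "linear_code (linear_code hull S)"
  by (rule hull_in) (fastforce simp: linear_code_def)

lemma linear_code_code_of: "linear_code (code_of G)"
  by (simp add: code_of_def linear_code_hull)

lemma row_in_code_of: "G $ i \<in> code_of G"
proof -
  have "G $ i \<in> rows G"
    by (auto simp: rows_def row_def)
  then show ?thesis
    by (simp add: code_of_def hull_inc)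
qed

lemma code_of_subset:
  assumes "\<And>i. G $ i \<in> C" "linear_code C"
  shows "code_of G \<subseteq> C"
proof -
  have "rows G \<subseteq> C"
    using assms(1) by (auto simp: rows_def row_def)
  then show ?thesis
    unfolding code_of_def using assms(2) by (rule hull_minimal)
qed

lemma code_of_G2: "code_of G2 = residue -` E2"
proof (rule equalityI)
  show "code_of G2 \<subseteq> residue -` E2"
  proof (rule code_of_subset)
    show "G2 $ i \<in> residue -` E2" for i
      using exhaust_2[of i] by (auto simp: G2_def E2_def gen_a_def gen_b_def)
  qed (metis linear_code_vimage_perp perp_E2)
  let ?C = "code_of G2"
  have add: "x + y \<in> ?C" if "x \<in> ?C" "y \<in> ?C" for x y
    using that linear_code_code_of[of G2] by (simp add: linear_code_def)
  have mult: "r *s x \<in> ?C" if "x \<in> ?C" for r x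
    using that linear_code_code_of[of G2] by (simp add: linear_code_def)
  show "residue -` E2 \<subseteq> ?C"
  proof
    fix c :: "i5 ^ 2" assume c: "c \<in> residue -` E2"
    define x y z where "x = a_coord (c $ 1)" and "y = b_coord (c $ 1)" and "z = b_coord (c $ 2)"
    \<comment> \<open>Row 1 supplies the residue (x, 2x). The ring multiple a * row 1 = (b, 2b)
      supplies the b-part of the first coordinate and contributes 2y to the second, which row 2
      corrects.\<close>
    have "c = (\<chi> i. x *\<^sub>5 G2 $ 1 $ i) + (\<chi> i. y *\<^sub>5 (gen_a *s G2 $ 1) $ i)
        + (\<chi> i. (z - 2 * y) *\<^sub>5 G2 $ 2 $ i)"
      using c by (simp add: vec_eq_iff forall_2 i5_eq_iff G2_def E2_def gen_a_def gen_b_def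
          x_def y_def z_def)
    moreover have "\<dots> \<in> ?C"
      by (intro add linear_code_scale[OF linear_code_code_of] mult row_in_code_of)
    ultimately show "c \<in> ?C"
      by simp
  qed
qed

lemma code_of_G4: "code_of G4 = residue -` E4"
proof (rule equalityI)
  show "code_of G4 \<subseteq> residue -` E4"
  proof (rule code_of_subset)
    show "G4 $ i \<in> residue -` E4" for i
      using exhaust_4[of i] by (auto simp: G4_def E4_def gen_a_def gen_b_def)
  qed (metis linear_code_vimage_perp perp_E4)
  let ?C = "code_of G4"
  have add: "x + y \<in> ?C" if "x \<in> ?C" "y \<in> ?C" for x y
    using that linear_code_code_of[of G4] by (simp add: linear_code_def)
  have mult: "r *s x \<in> ?C" if "x \<in> ?C" for r x
    using that linear_code_code_of[of G4] by (simp add: linear_code_def)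
  show "residue -` E4 \<subseteq> ?C"
  proof
    fix c :: "i5 ^ 4" assume c: "c \<in> residue -` E4"
    define x y where "x i = a_coord (c $ i)" and "y i = b_coord (c $ i)" for i
    \<comment> \<open>The decomposition used for \<open>G2\<close>, once on positions 1, 3 and once
      on positions 2, 4.\<close>
    have "c = (\<chi> i. x 1 *\<^sub>5 G4 $ 1 $ i) + (\<chi> i. y 1 *\<^sub>5 (gen_a *s G4 $ 1) $ i)
        + (\<chi> i. (y 3 - 2 * y 1) *\<^sub>5 G4 $ 3 $ i)
        + ((\<chi> i. x 2 *\<^sub>5 G4 $ 2 $ i) + (\<chi> i. y 2 *\<^sub>5 (gen_a *s G4 $ 2) $ i)
        + (\<chi> i. (y 4 - 2 * y 2) *\<^sub>5 G4 $ 4 $ i))"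
      using c by (simp add: vec_eq_iff forall_4 i5_eq_iff G4_def E4_def gen_a_def gen_b_def
          x_def y_def)
    moreover have "\<dots> \<in> ?C"
      by (intro add linear_code_scale[OF linear_code_code_of] mult row_in_code_of)
    ultimately show "c \<in> ?C"
      by simp
  qed
qed

section \<open>Dimensions of the residue codes, and types\<close>

lemma dim_E2: "vec.dim E2 = 1"
proof (rule vec.dim_unique)
  let ?u = "vector [1, 2] :: F5 ^ 2"
  show "{?u} \<subseteq> E2"
    by (simp add: E2_def)
  show "E2 \<subseteq> vec.span {?u}"
  proof
    fix v assume "v \<in> E2"
    then have "v = v $ 1 *s ?u"
      by (simp add: E2_def vec_eq_iff forall_2)
    then show "v \<in> vec.span {?u}"
      by (metis vec.span_base vec.span_scale singletonI)
  qed
  have "?u $ 1 \<noteq> 0 $ 1"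
    by simp
  then have "?u \<noteq> 0"
    by metis
  then show "vec.independent {?u}"
    by simp
qed simp

lemma dim_E4: "vec.dim E4 = 2"
proof (rule vec.dim_unique)
  let ?u = "vector [1, 0, 2, 0] :: F5 ^ 4" and ?v = "vector [0, 1, 0, 2] :: F5 ^ 4"
  show "{?u, ?v} \<subseteq> E4"
    by (simp add: E4_def)
  show "E4 \<subseteq> vec.span {?u, ?v}"
  proof
    fix w assume "w \<in> E4"
    then have "w = w $ 1 *s ?u + w $ 2 *s ?v"
      by (simp add: E4_def vec_eq_iff forall_4)
    then show "w \<in> vec.span {?u, ?v}"
      by (metis insertCI vec.span_add vec.span_base vec.span_scale)
  qed
  have "?v $ 2 \<noteq> 0 $ 2"
    by simp
  then have "?v \<noteq> 0"
    by metis
  moreover have "?u $ 1 \<noteq> (k *s ?v) $ 1" for k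
    by simp
  then have "?u \<noteq> k *s ?v" for k
    by metis
  then have "?u \<notin> vec.span {?v}"
    by (auto simp: vec.span_singleton)
  ultimately show "vec.independent {?u, ?v}"
    by (auto simp: vec.independent_insert)
  have "?u $ 1 \<noteq> ?v $ 1"
    by simp
  then have "?u \<noteq> ?v"
    by metis
  then show "card {?u, ?v} = 2"
    by simp
qed

lemma has_type_vimage:
  fixes D :: "(F5 ^ 'n) set"
  assumes "0 \<in> D" "vec.dim D = k" "CARD('n) = k + l"
  shows "has_type (residue -` D) k l"
  using assms by (simp add: has_type_def res_vimage tor_vimage card_cart_basis)


section \<open>Weight distributions\<close>

text \<open>Words of weight \<open>w\<close> in the preimage of \<open>E2\<close>, as pairs; they
  also describe one block of a word in the preimage of \<open>E4\<close>.\<close>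

definition pair_words :: "nat \<Rightarrow> (i5 \<times> i5) set" where
  "pair_words w =
     {(r, s). a_coord s = 2 * a_coord r \<and> of_bool (r \<noteq> 0) + of_bool (s \<noteq> 0) = w}"

instance i5 :: finite
proof
  have "(UNIV :: i5 set) = (\<lambda>(x, y). I5 x y) ` UNIV"
    by (auto simp: image_iff) (metis i5.exhaust)
  then show "finite (UNIV :: i5 set)"
    by (metis finite finite_imageI)
qed

lemma card_pair_words_0: "card (pair_words 0) = 1"
proof -
  have "pair_words 0 = {(0, 0)}"
    by (auto simp: pair_words_def)
  then show ?thesis
    by simp
qed

text \<open>One coordinate is 0, so both residues are 0 and the other coordinate is one of the 4
  nonzero multiples of b, in either position.\<close>

lemma card_pair_words_1: "card (pair_words 1) = 8"
proof -
  let ?N = "- {0 :: F5}"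
  let ?f = "\<lambda>y. (I5 0 y, 0 :: i5)" and ?g = "\<lambda>z. (0 :: i5, I5 0 z)"
  have "pair_words 1 = ?f ` ?N \<union> ?g ` ?N"
    by (auto simp: pair_words_def image_iff i5_eq_iff split: if_splits)
  moreover have "?f ` ?N \<inter> ?g ` ?N = {}"
    by (auto simp: i5_eq_iff)
  moreover have "card (?f ` ?N) = 4" "card (?g ` ?N) = 4"
    by (subst card_image; simp add: inj_on_def Compl_eq_Diff_UNIV card_Diff_subset UNIV_finite_5)+
  ultimately show ?thesis
    by (simp add: card_Un_disjoint)
qed

text \<open>The residue x and the two b-parts are free, giving 125 words in total; those of weight 0
  and 1 are subtracted.\<close>

lemma card_pair_words_2: "card (pair_words 2) = 116"
proof -
  let ?P = "(\<lambda>(x, y, z). (I5 x y, I5 (2 * x) z)) ` UNIV"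
  have P: "(r, s) \<in> ?P \<longleftrightarrow> a_coord s = 2 * a_coord r" for r s
    by (auto simp: image_iff i5_eq_iff)
  have "card ?P = 125"
    by (subst card_image) (auto simp: inj_on_def card_cartesian_product UNIV_finite_5 simp flip: UNIV_Times_UNIV)
  moreover have "?P = pair_words 0 \<union> pair_words 1 \<union> pair_words 2"
  proof (rule Set.set_eqI)
    fix x :: "i5 \<times> i5"
    obtain r s where x: "x = (r, s)"
      by fastforce
    show "x \<in> ?P \<longleftrightarrow> x \<in> pair_words 0 \<union> pair_words 1 \<union> pair_words 2"
      unfolding x P Un_iff by (auto simp: pair_words_def)
  qed
  moreover have "card (pair_words 0 \<union> pair_words 1 \<union> pair_words 2)
      = card (pair_words 0) + card (pair_words 1) + card (pair_words 2)"
    by (subst card_Un_disjoint; auto simp: pair_words_def)+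
  ultimately have "card (pair_words 0) + card (pair_words 1) + card (pair_words 2) = 125"
    by metis
  then show ?thesis
    using card_pair_words_0 card_pair_words_1 by linarith
qed

lemma pair_words_empty: "w > 2 \<Longrightarrow> pair_words w = {}"
  by (auto simp: pair_words_def)

lemma card_pair_words:
  "card (pair_words w) = (if w = 0 then 1 else if w = 1 then 8 else if w = 2 then 116 else 0)"
proof -
  consider "w = 0" | "w = 1" | "w = 2" | "w > 2"
    by linarith
  then show ?thesis
    using card_pair_words_0 card_pair_words_1 card_pair_words_2 pair_words_empty[of w]
    by cases simp_all
qed

lemma weight_eq_sum: "weight x = (\<Sum>i\<in>UNIV. of_bool (x $ i \<noteq> 0))"
  by (simp add: weight_def)

lemma weight_count_E2: "weight_count (residue -` E2) w = card (pair_words w)"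
proof -
  have "bij_betw (\<lambda>c. (c $ 1, c $ 2)) {c \<in> residue -` E2. weight c = w} (pair_words w)"
    by (rule bij_betw_byWitness[where f' = "\<lambda>(r, s). vector [r, s]"])
      (auto simp: E2_def pair_words_def weight_eq_sum sum_2 vec_eq_iff forall_2)
  then show ?thesis
    unfolding weight_count_def by (rule bij_betw_same_card)
qed

text \<open>A word consists of two independent blocks whose weights add, so the distribution is the
  convolution of that of \<open>E2\<close> with itself.\<close>

lemma weight_count_E4:
  "weight_count (residue -` E4) w = (\<Sum>i\<le>w. card (pair_words i) * card (pair_words (w - i)))"
proof -
  have "bij_betw (\<lambda>c. ((c $ 1, c $ 3), (c $ 2, c $ 4))) {c \<in> residue -` E4. weight c = w}
      (\<Union>i\<le>w. pair_words i \<times> pair_words (w - i))"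
  proof (rule bij_betw_byWitness[where f' = "\<lambda>((r, s), (r', s')). vector [r, r', s, s']"])
    show "(\<lambda>c. ((c $ 1, c $ 3), (c $ 2, c $ 4))) ` {c \<in> residue -` E4. weight c = w}
        \<subseteq> (\<Union>i\<le>w. pair_words i \<times> pair_words (w - i))"
    proof (intro image_subsetI UN_I)
      fix c :: "i5 ^ 4" assume "c \<in> {c \<in> residue -` E4. weight c = w}"
      then have c: "c \<in> residue -` E4" and w: "w = weight c"
        by auto
      \<comment> \<open>The weight on the first block, positions 1 and 3.\<close>
      let ?i = "of_bool (c $ 1 \<noteq> 0) + of_bool (c $ 3 \<noteq> 0) :: nat"
      show "?i \<in> {..w}"
        by (simp add: w weight_eq_sum sum_4)
      show "((c $ 1, c $ 3), c $ 2, c $ 4) \<in> pair_words ?i \<times> pair_words (w - ?i)"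
        using c by (simp add: w weight_eq_sum sum_4 E4_def pair_words_def)
    qed
    show "(\<lambda>((r, s), (r', s')). vector [r, r', s, s'])
        ` (\<Union>i\<le>w. pair_words i \<times> pair_words (w - i)) \<subseteq> {c \<in> residue -` E4. weight c = w}"
    proof (rule image_subsetI, clarify)
      fix i r s r' s'
      assume "i \<le> w" "(r, s) \<in> pair_words i" "(r', s') \<in> pair_words (w - i)"
      moreover have "weight (vector [r, r', s, s'] :: i5 ^ 4) =
          (of_bool (r \<noteq> 0) + of_bool (s \<noteq> 0)) + (of_bool (r' \<noteq> 0) + of_bool (s' \<noteq> 0))"
        by (simp add: weight_eq_sum sum_4)
      ultimately show
        "vector [r, r', s, s'] \<in> residue -` E4 \<and> weight (vector [r, r', s, s'] :: i5 ^ 4) = w"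
        by (simp only: pair_words_def mem_Collect_eq prod.case) (simp add: E4_def)
    qed
    show "\<forall>c\<in>{c \<in> residue -` E4. weight c = w}.
        (\<lambda>((r, s), (r', s')). vector [r, r', s, s']) ((c $ 1, c $ 3), (c $ 2, c $ 4)) = c"
      by (simp add: vec_eq_iff forall_4)
  qed (simp add: split_beta)
  then have "weight_count (residue -` E4) w = card (\<Union>i\<le>w. pair_words i \<times> pair_words (w - i))"
    unfolding weight_count_def by (rule bij_betw_same_card)
  also have "\<dots> = (\<Sum>i\<le>w. card (pair_words i \<times> pair_words (w - i)))"
    by (rule card_UN_disjoint) (auto simp: pair_words_def)
  finally show ?thesis
    by (simp add: card_cartesian_product)
qed

lemma min_distance_eq_1:
  assumes "weight_count C 1 \<noteq> 0"
  shows "min_distance C = 1"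
  unfolding min_distance_def
proof (rule Least_equality)
  have "{c \<in> C. weight c = 1} \<noteq> {}"
    using assms unfolding weight_count_def by (metis card.empty)
  then obtain c where "c \<in> C" "weight c = 1"
    by blast
  moreover have "weight (0 :: i5 ^ 'a) = 0"
    by (simp add: weight_def)
  ultimately show "\<exists>c\<in>C. c \<noteq> 0 \<and> weight c = 1"
    by (metis zero_neq_one)
next
  fix w assume "\<exists>c\<in>C. c \<noteq> 0 \<and> weight c = w"
  then obtain c where "c \<in> C" "c \<noteq> 0" "weight c = w"
    by blast
  then show "1 \<le> w"
    by (auto simp: weight_def vec_eq_iff Suc_le_eq card_gt_0_iff)
qed


section \<open>Automorphism groups\<close>

lemma signed_perm_eqD:
  assumes "signed_perm p s = signed_perm q t" "s i \<noteq> 0"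
  shows "p i = q i" "s i = t i"
proof -
  have "signed_perm p s $ i $ p i = signed_perm q t $ i $ p i"
    by (simp only: assms(1))
  then show "p i = q i" "s i = t i"
    using assms(2) by (auto simp: signed_perm_def split: if_splits)
qed

text \<open>The position paired with \<open>i\<close> is \<open>i + 1\<close> in length 2 and \<open>i + 2\<close> in length 4 (indices are
  modulo the length); the two codes satisfy \<open>orient i * v $ (i + n div 2) = 2 * v $ i\<close> at every \<open>i\<close>,
  because \<open>2 * 2 = - 1\<close>.\<close>

definition orient2 :: "2 \<Rightarrow> F5" where
  "orient2 i = (if i = 1 then 1 else - 1)"

definition orient4 :: "4 \<Rightarrow> F5" where
  "orient4 i = (if i = 1 \<or> i = 2 then 1 else - 1)"

text \<open>The swap turns (1, 2) into (2, 1) = 2 (1, -2), so it needs a relative sign -1, while the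
  identity needs 1. The generator alone detects this; \<open>s 1\<close> stays free.\<close>

lemma preserves_E2_iff:
  fixes p :: "2 \<Rightarrow> 2"
  assumes p: "bij p" and s: "\<forall>i. s i \<in> {1, - 1}"
  shows "{v. (\<chi> i. s i * v $ p i) \<in> E2} = E2 \<longleftrightarrow> p 2 = p 1 + 1 \<and> s 2 = orient2 (p 1) * s 1"
    (is "?L \<longleftrightarrow> ?R")
proof
  have ne: "p 1 \<noteq> p 2"
    by (simp_all add: inj_eq[OF bij_is_inj[OF p]])
  have sgn: "s 1 = 1 \<or> s 1 = - 1" "s 2 = 1 \<or> s 2 = - 1"
    using s by auto
  {
    assume L: ?L
    have "vector [1, 2] \<in> E2"
      by (simp add: E2_def)
    then have "vector [1, 2] \<in> {v. (\<chi> i. s i * v $ p i) \<in> E2}"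
      by (simp only: L)
    then have "s 2 * (vector [1, 2] :: F5 ^ 2) $ p 2 = 2 * (s 1 * vector [1, 2] $ p 1)"
      by (simp add: E2_def)
    then show ?R
      using ne sgn exhaust_2[of "p 1"] exhaust_2[of "p 2"]
      by (elim disjE; simp add: orient2_def)
  }
  \<comment> \<open>The value of \<open>p 1 + 1\<close> at \<open>p 1 = 2\<close>, computed modulo
    2.\<close>
  have wrap: "(3 :: 2) = 1"
    by simp
  assume ?R
  then have "s 2 * v $ p 2 = 2 * (s 1 * v $ p 1) \<longleftrightarrow> v $ 2 = 2 * v $ 1" for v :: "F5 ^ 2"
    using sgn exhaust_2[of "p 1"] wrap
    by (elim disjE; simp add: orient2_def)
  then show ?L
    by (simp add: E2_def)
qed

lemma numeral_4_wrap: "(5::4) = 1" "(6::4) = 2"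
  by simp_all

text \<open>Coordinates in different blocks are independent on \<open>E4\<close>, so the two must
  share a block. The basis words (1, 0, 2, 0) and (0, 1, 0, 2) show this and fix the relative
  sign.\<close>

lemma preserves_E4_row:
  fixes i k :: 4
  assumes "s \<in> {1, - 1}" "t \<in> {1, - 1}" "i \<noteq> k" and E: "\<And>v. v \<in> E4 \<Longrightarrow> t * v $ k = 2 * (s * v $ i)"
  shows "k = i + 2 \<and> t = orient4 i * s"
proof -
  have "t * vector [1, 0, 2, 0] $ k = 2 * (s * vector [1, 0, 2, 0] $ i)"
    "t * vector [0, 1, 0, 2] $ k = 2 * (s * vector [0, 1, 0, 2] $ i)"
    by (simp_all add: E E4_def)
  then show ?thesis
    using assms(1-3) exhaust_4[of i] exhaust_4[of k]
    by (elim disjE insertE emptyE; simp add: orient4_def)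
qed

lemma preserves_E4_iff:
  fixes p :: "4 \<Rightarrow> 4"
  assumes p: "bij p" and s: "\<forall>i. s i \<in> {1, - 1}"
  shows "{v. (\<chi> i. s i * v $ p i) \<in> E4} = E4 \<longleftrightarrow>
    p 3 = p 1 + 2 \<and> s 3 = orient4 (p 1) * s 1 \<and> p 4 = p 2 + 2 \<and> s 4 = orient4 (p 2) * s 2"
    (is "?L \<longleftrightarrow> ?R")
proof
  have ne: "p 1 \<noteq> p 2" "p 1 \<noteq> p 3" "p 2 \<noteq> p 3" "p 2 \<noteq> p 4"
    by (simp_all add: inj_eq[OF bij_is_inj[OF p]])
  {
    assume ?L
    then have "s 3 * v $ p 3 = 2 * (s 1 * v $ p 1)" "s 4 * v $ p 4 = 2 * (s 2 * v $ p 2)"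
      if "v \<in> E4" for v
      using that by (auto simp: E4_def)
    then show ?R
      using preserves_E4_row[OF s[rule_format] s[rule_format] ne(2)]
        preserves_E4_row[OF s[rule_format] s[rule_format] ne(4)] by blast
  }
  assume ?R
  have sgn: "s 1 = 1 \<or> s 1 = - 1" "s 2 = 1 \<or> s 2 = - 1"
    using s by auto
  have pair: "orient4 i * x * v $ (i + 2) = 2 * (x * v $ i) \<longleftrightarrow>
      (if i = 1 \<or> i = 3 then v $ 3 = 2 * v $ 1 else v $ 4 = 2 * v $ 2)"
    if "x = 1 \<or> x = - 1" for x i and v :: "F5 ^ 4"
    using that exhaust_4[of i] by (auto simp: orient4_def numeral_4_wrap)
  have "p 2 \<noteq> p 1 + 2" "p 1 \<noteq> p 2"
    using ne \<open>?R\<close> by auto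
  \<comment> \<open>Positions 1 and 2 are sent into different blocks, so the two transported
    equations are the two equations of \<open>E4\<close>, in some order.\<close>
  then have parity: "(p 1 = 1 \<or> p 1 = 3) \<longleftrightarrow> \<not> (p 2 = 1 \<or> p 2 = 3)"
    using exhaust_4[of "p 1"] exhaust_4[of "p 2"] by auto
  have "s 3 * v $ p 3 = 2 * (s 1 * v $ p 1) \<and> s 4 * v $ p 4 = 2 * (s 2 * v $ p 2) \<longleftrightarrow>
      v $ 3 = 2 * v $ 1 \<and> v $ 4 = 2 * v $ 2" for v :: "F5 ^ 4"
    using \<open>?R\<close> pair[OF sgn(1), of "p 1" v] pair[OF sgn(2), of "p 2" v] parity
    by (auto split: if_splits)
  then show ?L
    by (simp add: E4_def)
qed

text \<open>The image of position 1 and its sign are free and determine everything else: 2 * 2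
  choices.\<close>

lemma order_Aut_E2: "Coset.order (Aut (residue -` E2)) = 4"
proof -
  define p :: "2 \<Rightarrow> 2 \<Rightarrow> 2" where "p i r = (if r = 1 then i else i + 1)" for i r
  define t :: "2 \<Rightarrow> F5 \<Rightarrow> 2 \<Rightarrow> F5" where
    "t i x r = (if r = 1 then x else orient2 i * x)" for i x r
  let ?f = "\<lambda>(i, x). signed_perm (p i) (t i x)"
  let ?A = "UNIV \<times> {1, - 1} :: (2 \<times> F5) set"
  have bij: "bij (p i)" for i
  proof -
    have "inj (p i)"
      using exhaust_2[of i] by (auto simp: p_def inj_def forall_2)
    then show ?thesis
      by (simp add: bij_def finite_UNIV_inj_surj)
  qed
  have t: "\<forall>r. t i x r \<in> {1, - 1}" if "x \<in> {1, - 1}" for i x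
    using that by (auto simp: t_def orient2_def)
  have "carrier (Aut (residue -` E2)) = ?f ` ?A"
  proof (intro equalityI subsetI)
    fix M assume "M \<in> carrier (Aut (residue -` E2))"
    then obtain q s where q: "bij q" "\<forall>i. s i \<in> {1, - 1}" "M = signed_perm q s"
      "q 2 = q 1 + 1" "s 2 = orient2 (q 1) * s 1"
      using preserves_E2_iff by (auto simp: carrier_Aut_vimage)
    then have "q = p (q 1)" "s = t (q 1) (s 1)"
      by (auto simp: fun_eq_iff forall_2 p_def t_def)
    then show "M \<in> ?f ` ?A"
      using q(2,3) by (intro image_eqI[of _ _ "(q 1, s 1)"]) auto
  next
    fix M assume "M \<in> ?f ` ?A"
    then obtain i x where M: "M = signed_perm (p i) (t i x)" "x \<in> {1, - 1}"
      by auto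
    have "{v. (\<chi> r. t i x r * v $ p i r) \<in> E2} = E2"
      unfolding preserves_E2_iff[OF bij t[OF M(2)]] by (simp add: p_def t_def)
    then show "M \<in> carrier (Aut (residue -` E2))"
      unfolding carrier_Aut_vimage using M bij t by blast
  qed
  moreover have "inj_on ?f ?A"
  proof (rule inj_onI, clarify)
    fix i j x y
    assume "x \<in> {1, - 1}" "y \<in> {1, - 1}" and eq: "signed_perm (p i) (t i x) = signed_perm (p j) (t j y)"
    then have "t i x 1 \<noteq> 0"
      by (auto simp: t_def)
    from signed_perm_eqD[OF eq this] show "i = j \<and> x = y"
      by (simp add: p_def t_def)
  qed
  moreover have "card ?A = 4"
    by (simp add: card_cartesian_product)
  ultimately show ?thesis
    by (simp only: Coset.order_def card_image)
qed

lemma add_two_add_two_4: "i + 2 + 2 = i" for i :: 4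
  using exhaust_4[of i] by (elim disjE; simp)

lemma card_antipodal_compl_4: "card (- {i, i + 2}) = 2" for i :: 4
proof -
  have "i \<noteq> i + 2"
    by simp
  then have "card {i, i + 2} = 2"
    by (rule card_2_iff[THEN iffD2, OF exI, OF exI, OF conjI[OF refl]])
  then show ?thesis
    by (simp only: Compl_eq_Diff_UNIV card_Diff_subset finite subset_UNIV) simp
qed

text \<open>Position 1 has 4 images, position 2 then has 2 images outside the block of the first,
  and the signs at 1 and 2 are free: 4 * 2 * 2 * 2 choices.\<close>

lemma order_Aut_E4: "Coset.order (Aut (residue -` E4)) = 32"
proof -
  define p :: "4 \<Rightarrow> 4 \<Rightarrow> 4 \<Rightarrow> 4" where
    "p i j r = (if r = 1 then i else if r = 2 then j else if r = 3 then i + 2 else j + 2)" for i j r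
  define t :: "4 \<Rightarrow> 4 \<Rightarrow> F5 \<Rightarrow> F5 \<Rightarrow> 4 \<Rightarrow> F5" where
    "t i j x y r = (if r = 1 then x else if r = 2 then y
      else if r = 3 then orient4 i * x else orient4 j * y)" for i j x y r
  let ?f = "\<lambda>((i, j), x, y). signed_perm (p i j) (t i j x y)"
  let ?A = "(SIGMA i:UNIV. - {i, i + 2}) \<times> {1, - 1} \<times> {1, - 1} :: ((4 \<times> 4) \<times> F5 \<times> F5) set"
  have bij: "bij (p i j)" if "j \<noteq> i" "j \<noteq> i + 2" for i j
  proof -
    have "i \<noteq> i + 2" "j \<noteq> j + 2" "i + 2 \<noteq> j + 2"
      using that(1) by simp_all
    moreover have "i \<noteq> j + 2"
      using that(2) add_two_add_two_4[of j] by auto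
    ultimately have "inj (p i j)"
      using that
      unfolding inj_def forall_4 p_def by simp
    then show ?thesis
      by (simp add: bij_def finite_UNIV_inj_surj)
  qed
  have t: "\<forall>r. t i j x y r \<in> {1, - 1}" if "x \<in> {1, - 1}" "y \<in> {1, - 1}" for i j x y
    using that by (auto simp: t_def orient4_def)
  have "carrier (Aut (residue -` E4)) = ?f ` ?A"
  proof (intro equalityI subsetI)
    fix M assume "M \<in> carrier (Aut (residue -` E4))"
    then obtain q s where q: "bij q" "\<forall>i. s i \<in> {1, - 1}" "M = signed_perm q s"
      and "{v. (\<chi> i. s i * v $ q i) \<in> E4} = E4"
      unfolding carrier_Aut_vimage by blast
    then have rel:
      "q 3 = q 1 + 2" "s 3 = orient4 (q 1) * s 1" "q 4 = q 2 + 2" "s 4 = orient4 (q 2) * s 2"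
      using preserves_E4_iff[OF q(1,2)] by auto
    then have "q = p (q 1) (q 2)" "s = t (q 1) (q 2) (s 1) (s 2)"
      by (auto simp: fun_eq_iff forall_4 p_def t_def)
    moreover have "q 2 \<noteq> q 1" "q 2 \<noteq> q 3"
      by (simp_all add: inj_eq[OF bij_is_inj[OF q(1)]])
    ultimately show "M \<in> ?f ` ?A"
      using q(2,3) rel(1) by (intro image_eqI[of _ _ "((q 1, q 2), s 1, s 2)"]) auto
  next
    fix M assume "M \<in> ?f ` ?A"
    then obtain i j x y where M: "M = signed_perm (p i j) (t i j x y)" "x \<in> {1, - 1}" "y \<in> {1, - 1}"
      and "j \<noteq> i" "j \<noteq> i + 2"
      by auto
    note b = bij[OF this(4,5)]
    have "{v. (\<chi> r. t i j x y r * v $ p i j r) \<in> E4} = E4"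
      unfolding preserves_E4_iff[OF b t[OF M(2,3)]] by (simp add: p_def t_def)
    then show "M \<in> carrier (Aut (residue -` E4))"
      unfolding carrier_Aut_vimage using M(1) b t[OF M(2,3)] by blast
  qed
  moreover have "inj_on ?f ?A"
  proof (rule inj_onI)
    fix a b assume a: "a \<in> ?A" and eq: "?f a = ?f b"
    obtain i j x y where ij: "a = ((i, j), x, y)"
      by (metis surj_pair)
    obtain i' j' x' y' where ij': "b = ((i', j'), x', y')"
      by (metis surj_pair)
    have eq: "signed_perm (p i j) (t i j x y) = signed_perm (p i' j') (t i' j' x' y')"
      using eq by (simp add: ij ij')
    \<comment> \<open>The nonzero entries in rows 1 and 2 of the matrix recover i, x and j,
      y.\<close>
    have "t i j x y 1 \<noteq> 0" "t i j x y 2 \<noteq> 0"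
      using a by (auto simp: ij t_def)
    from signed_perm_eqD[OF eq this(1)] signed_perm_eqD[OF eq this(2)]
    show "a = b"
      by (simp add: ij ij' p_def t_def)
  qed
  moreover have "card ?A = 32"
  proof -
    have "card (SIGMA i:UNIV. - {i, i + 2 :: 4}) = 8"
      by (subst card_SigmaI) (simp_all only: finite card_antipodal_compl_4 sum_constant card_bit0, simp_all)
    moreover have "card {1, - 1 :: F5} = 2"
      by simp
    ultimately show ?thesis
      by (simp only: card_cartesian_product)
  qed
  ultimately show ?thesis
    by (simp only: Coset.order_def card_image)
qed

theorem mainTheorem8:
  shows
    "card ({C :: (i5 ^ 2) set. self_dual C} // monomial_equiv) = 1 \<and>
     card ({C :: (i5 ^ 4) set. self_dual C} // monomial_equiv) = 1 \<and>
     self_dual (code_of G2) \<and>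
     self_dual (code_of G4) \<and>
     has_type (code_of G2) 1 1 \<and>
     has_type (code_of G4) 2 2 \<and>
     Coset.order (Aut (code_of G2)) = 4 \<and>
     Coset.order (Aut (code_of G4)) = 32 \<and>
     min_distance (code_of G2) = 1 \<and>
     min_distance (code_of G4) = 1 \<and>
     weight_count (code_of G2) 1 = 8 \<and>
     weight_count (code_of G2) 2 = 116 \<and>
     weight_count (code_of G4) 1 = 16 \<and>
     weight_count (code_of G4) 2 = 296 \<and>
     weight_count (code_of G4) 3 = 1856 \<and>
     weight_count (code_of G4) 4 = 13456"
proof -
  have sd: "self_dual (residue -` E2)" "self_dual (residue -` E4)"
    by (simp_all add: self_dual_vimage perp_E2 perp_E4)
  have "card ({C :: (i5 ^ 2) set. self_dual C} // monomial_equiv) = 1"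
    by (rule card_quotient_eq_1[OF equiv_monomial_equiv])
      (use sd(1) self_dual_2_equiv in simp_all)
  moreover have "card ({C :: (i5 ^ 4) set. self_dual C} // monomial_equiv) = 1"
    by (rule card_quotient_eq_1[OF equiv_monomial_equiv])
      (use sd(2) self_dual_4_equiv in simp_all)
  moreover have "has_type (residue -` E2) 1 1" "has_type (residue -` E4) 2 2"
    by (rule has_type_vimage; simp add: E2_def E4_def dim_E2[unfolded E2_def] dim_E4[unfolded E4_def])+
  \<comment> \<open>These are coefficients of the weight enumerator 1 + 8z + 116z^2 and of its
    square.\<close>
  moreover have "weight_count (residue -` E2) 1 = 8" "weight_count (residue -` E2) 2 = 116"
    "weight_count (residue -` E4) 1 = 16" "weight_count (residue -` E4) 2 = 296"
    "weight_count (residue -` E4) 3 = 1856" "weight_count (residue -` E4) 4 = 13456"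
    by (simp_all add: weight_count_E2 weight_count_E4 card_pair_words atMost_nat_numeral atMost_Suc)
  ultimately show ?thesis
    unfolding code_of_G2 code_of_G4
    using sd order_Aut_E2 order_Aut_E4 by (simp add: min_distance_eq_1)
qed

end
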